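(* Let $\rho\in(1/2,1)$, $T>0$ and $\mu\in\mathcal{D}([0,T],\mathcal{S}')$. If $Q^{\rm asym}_{\rm dyn}(\mu)<+\infty$, then $Q^{\rm asym}_{\rm dyn}(\mu)=0$.
   Context: $\mathcal{S}$ is the Schwartz space on $\mathbb{R}$, $\mathcal{S}'$ its dual, and $\mathcal{D}([0,T],\mathcal{S}')$ the Skorokhod space of $\mathcal{S}'$-valued trajectories on $[0,T]$. $\mathcal{C}^{1,\infty}_c([0,T]\times\mathbb{R})$ is the space of compactly supported functions on $[0,T]\times\mathbb{R}$ that are continuously differentiable in the first variable and smooth in the second; $H_t=H(t,\cdot)$ and $\nabla$ is the space derivative. Let $A(\rho)=(1-\rho)(2\rho-1)/\rho$ and let $A'$ be its derivative. Define $$Q^{\rm asym}_{\rm dyn}(\mu)=\sup_{H\in\mathcal{C}^{1,\infty}_c([0,T]\times\mathbb{R})}\Big\{\mu_T(H_T)-\mu_0(H_0)-\int_0^T\mu_s\big((\partial_s+A'(\rho)\nabla)H_s\big)ds\Big\}.$$ *)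

theory Defs
  imports "HOL-Analysis.Analysis"
begin

section \<open>The Schwartz space on the real line\<close>

definition smooth :: "(real \<Rightarrow> real) \<Rightarrow> bool" where
  "smooth f \<longleftrightarrow> (\<forall>k x. (deriv ^^ k) f differentiable (at x))"

definition schwartz_functions :: "(real \<Rightarrow> real) set" where
  "schwartz_functions =
     {f. smooth f \<and> (\<forall>m k. bounded (range (\<lambda>x. x ^ m * (deriv ^^ k) f x)))}"

lemma smooth_DERIV:
  assumes "smooth f"
  shows "((deriv ^^ k) f has_real_derivative (deriv ^^ Suc k) f x) (at x)"
  using assms by (simp add: smooth_def DERIV_deriv_iff_real_differentiable)

lemma higher_deriv_lincomb:
  assumes "smooth f" "smooth g"
  shows "(deriv ^^ k) (\<lambda>x. a * f x + b * g x) =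
           (\<lambda>x. a * (deriv ^^ k) f x + b * (deriv ^^ k) g x)"
proof (induction k)
  case (Suc k)
  have "((\<lambda>x. a * (deriv ^^ k) f x + b * (deriv ^^ k) g x) has_real_derivative
          (a * (deriv ^^ Suc k) f x + b * (deriv ^^ Suc k) g x)) (at x)" for x
    by (intro DERIV_add DERIV_cmult smooth_DERIV assms)
  then show ?case
    using Suc by (auto intro!: ext DERIV_imp_deriv)
qed simp

lemma smooth_lincomb:
  assumes "smooth f" "smooth g"
  shows "smooth (\<lambda>x. a * f x + b * g x)"
  unfolding smooth_def
proof (intro allI)
  fix k x
  have "((\<lambda>x. a * (deriv ^^ k) f x + b * (deriv ^^ k) g x) has_real_derivative
          (a * (deriv ^^ Suc k) f x + b * (deriv ^^ Suc k) g x)) (at x)"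
    by (intro DERIV_add DERIV_cmult smooth_DERIV assms)
  then show "(deriv ^^ k) (\<lambda>x. a * f x + b * g x) differentiable (at x)"
    unfolding higher_deriv_lincomb[OF assms] real_differentiable_def by blast
qed

lemma smooth_deriv:
  assumes "smooth f"
  shows "smooth (deriv f)"
  unfolding smooth_def
proof (intro allI)
  fix k x
  have "(deriv ^^ Suc k) f differentiable (at x)"
    using assms unfolding smooth_def by blast
  then show "(deriv ^^ k) (deriv f) differentiable (at x)"
    by (simp add: funpow_swap1)
qed

lemma schwartz_functions_lincomb:
  assumes "f \<in> schwartz_functions" "g \<in> schwartz_functions"
  shows "(\<lambda>x. a * f x + b * g x) \<in> schwartz_functions"
proof -
  have s: "smooth f" "smooth g"
    using assms by (auto simp: schwartz_functions_def)
  have "bounded (range (\<lambda>x. x ^ m * (deriv ^^ k) (\<lambda>x. a * f x + b * g x) x))" for m k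
  proof -
    have "bounded (range (\<lambda>x. a *\<^sub>R (x ^ m * (deriv ^^ k) f x) + b *\<^sub>R (x ^ m * (deriv ^^ k) g x)))"
      using assms
      by (intro bounded_plus_comp bounded_scaleR_comp) (auto simp: schwartz_functions_def)
    then show ?thesis
      unfolding higher_deriv_lincomb[OF s] by (simp add: algebra_simps)
  qed
  then show ?thesis
    using smooth_lincomb[OF s] by (simp add: schwartz_functions_def)
qed

lemma zero_schwartz_functions: "(\<lambda>x. 0) \<in> schwartz_functions"
proof -
  have "(deriv ^^ k) (\<lambda>x::real. 0::real) = (\<lambda>x. 0)" for k
    by (induction k) auto
  then show ?thesis
    by (auto simp: schwartz_functions_def smooth_def)
qed

lemma schwartz_functions_if_vanishing:
  assumes s: "smooth f" and v: "\<And>x. \<bar>x\<bar> > R \<Longrightarrow> f x = 0"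
  shows "f \<in> schwartz_functions"
proof -
  have v': "(deriv ^^ k) f x = 0" if "\<bar>x\<bar> > R" for k x
    using that
  proof (induction k arbitrary: x)
    case (Suc k)
    have "open {y::real. \<bar>y\<bar> > R}"
      by (intro open_Collect_less continuous_intros)
    then have "eventually (\<lambda>y. y \<in> {y. \<bar>y\<bar> > R}) (nhds x)"
      using Suc.prems by (intro eventually_nhds_in_open) auto
    then have "eventually (\<lambda>y. (deriv ^^ k) f y = 0) (nhds x)"
      by eventually_elim (use Suc.IH in auto)
    then have "deriv ((deriv ^^ k) f) x = deriv (\<lambda>_. 0) x"
      by (intro deriv_cong_ev) auto
    then show ?case by simp
  qed (use v in auto)
  have "bounded (range (\<lambda>x. x ^ m * (deriv ^^ k) f x))" for m k
  proof -
    have "continuous_on {-R..R} (\<lambda>x. x ^ m * (deriv ^^ k) f x)"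
      by (intro continuous_intros DERIV_continuous_on[OF DERIV_subset[OF smooth_DERIV[OF s]]]) auto
    then have "bounded ((\<lambda>x. x ^ m * (deriv ^^ k) f x) ` {-R..R})"
      by (intro compact_imp_bounded compact_continuous_image) auto
    moreover have "range (\<lambda>x. x ^ m * (deriv ^^ k) f x) \<subseteq>
                     insert 0 ((\<lambda>x. x ^ m * (deriv ^^ k) f x) ` {-R..R})"
    proof (rule image_subsetI)
      fix x :: real
      show "x ^ m * (deriv ^^ k) f x \<in> insert 0 ((\<lambda>x. x ^ m * (deriv ^^ k) f x) ` {-R..R})"
      proof (cases "\<bar>x\<bar> > R")
        case True
        then show ?thesis using v' by simp
      next
        case False
        then have "x \<in> {-R..R}" by auto
        then show ?thesis by blast
      qed
    qed
    ultimately show ?thesis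
      by (meson bounded_insert bounded_subset)
  qed
  then show ?thesis
    using s by (simp add: schwartz_functions_def)
qed

typedef schwartz = schwartz_functions
  morphisms schwartz_fun Abs_schwartz
  using zero_schwartz_functions by blast

setup_lifting type_definition_schwartz

instantiation schwartz :: real_vector
begin

lift_definition zero_schwartz :: schwartz is "\<lambda>x. 0"
  by (rule zero_schwartz_functions)

lift_definition plus_schwartz :: "schwartz \<Rightarrow> schwartz \<Rightarrow> schwartz" is "\<lambda>f g x. f x + g x"
  using schwartz_functions_lincomb[where a = 1 and b = 1] by simp

lift_definition minus_schwartz :: "schwartz \<Rightarrow> schwartz \<Rightarrow> schwartz" is "\<lambda>f g x. f x - g x"
  using schwartz_functions_lincomb[where a = 1 and b = "-1"] by simp

lift_definition uminus_schwartz :: "schwartz \<Rightarrow> schwartz" is "\<lambda>f x. - f x"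
  using schwartz_functions_lincomb[where a = "-1" and b = 0] by fastforce

lift_definition scaleR_schwartz :: "real \<Rightarrow> schwartz \<Rightarrow> schwartz" is "\<lambda>c f x. c * f x"
  subgoal for c f using schwartz_functions_lincomb[of f f c 0] by simp
  done

instance
  by standard (transfer; simp add: algebra_simps)+

end

definition schwartz_seminorm :: "nat \<Rightarrow> nat \<Rightarrow> schwartz \<Rightarrow> real" where
  "schwartz_seminorm m k f = (SUP x. \<bar>x ^ m * (deriv ^^ k) (schwartz_fun f) x\<bar>)"

text \<open>The locally convex topology generated by the seminorms.\<close>

instantiation schwartz :: topological_space
begin

definition open_schwartz :: "schwartz set \<Rightarrow> bool" where
  "open_schwartz U \<longleftrightarrow>
     (\<forall>f\<in>U. \<exists>N. \<exists>e>0. \<forall>g. (\<forall>m\<le>N. \<forall>k\<le>N. schwartz_seminorm m k (g - f) < e) \<longrightarrow> g \<in> U)"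

instance
proof
  show "open (UNIV :: schwartz set)"
    unfolding open_schwartz_def by (auto intro: exI[of _ 1])
next
  fix U V :: "schwartz set"
  assume UV: "open U" "open V"
  show "open (U \<inter> V)"
    unfolding open_schwartz_def
  proof
    fix f assume f: "f \<in> U \<inter> V"
    obtain N e where 1: "e > 0"
      "\<And>g. (\<forall>m\<le>N. \<forall>k\<le>N. schwartz_seminorm m k (g - f) < e) \<Longrightarrow> g \<in> U"
      using UV f unfolding open_schwartz_def by blast
    obtain N' e' where 2: "e' > 0"
      "\<And>g. (\<forall>m\<le>N'. \<forall>k\<le>N'. schwartz_seminorm m k (g - f) < e') \<Longrightarrow> g \<in> V"
      using UV f unfolding open_schwartz_def by blast
    show "\<exists>N. \<exists>e>0. \<forall>g. (\<forall>m\<le>N. \<forall>k\<le>N. schwartz_seminorm m k (g - f) < e) \<longrightarrow> g \<in> U \<inter> V"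
    proof (rule exI[of _ "max N N'"], rule exI[of _ "min e e'"], intro conjI allI impI)
      show "min e e' > 0" using 1 2 by simp
      fix g
      assume "\<forall>m\<le>max N N'. \<forall>k\<le>max N N'. schwartz_seminorm m k (g - f) < min e e'"
      then show "g \<in> U \<inter> V"
        using 1(2)[of g] 2(2)[of g] by simp
    qed
  qed
next
  fix K :: "schwartz set set"
  assume "\<forall>U\<in>K. open U"
  then show "open (\<Union>K)"
    unfolding open_schwartz_def by (meson UnionE UnionI)
qed

end


section \<open>Tempered distributions\<close>

typedef tempered = "{\<mu> :: schwartz \<Rightarrow> real. linear \<mu> \<and> continuous_on UNIV \<mu>}"
  morphisms pairing Abs_tempered
  by (intro exI[of _ "\<lambda>_. 0"]) (simp add: linear_zero)

definition schwartz_bounded :: "schwartz set \<Rightarrow> bool" where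
  "schwartz_bounded B \<longleftrightarrow> (\<forall>m k. bdd_above (schwartz_seminorm m k ` B))"

text \<open>
  The dual carries the strong topology, that of uniform convergence on bounded sets.
\<close>

instantiation tempered :: topological_space
begin

definition open_tempered :: "tempered set \<Rightarrow> bool" where
  "open_tempered U \<longleftrightarrow>
     (\<forall>\<mu>\<in>U. \<exists>B. schwartz_bounded B \<and>
        (\<exists>e>0. \<forall>\<nu>. (\<forall>f\<in>B. \<bar>pairing \<nu> f - pairing \<mu> f\<bar> < e) \<longrightarrow> \<nu> \<in> U))"

instance
proof
  show "open (UNIV :: tempered set)"
    unfolding open_tempered_def schwartz_bounded_def
    by (auto intro!: exI[of _ "{}"] exI[of _ 1])
next
  fix U V :: "tempered set"
  assume UV: "open U" "open V"
  show "open (U \<inter> V)"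
    unfolding open_tempered_def
  proof
    fix \<mu> assume \<mu>: "\<mu> \<in> U \<inter> V"
    obtain B e where 1: "schwartz_bounded B" "e > 0"
      "\<And>\<nu>. (\<forall>f\<in>B. \<bar>pairing \<nu> f - pairing \<mu> f\<bar> < e) \<Longrightarrow> \<nu> \<in> U"
      using UV \<mu> unfolding open_tempered_def by blast
    obtain B' e' where 2: "schwartz_bounded B'" "e' > 0"
      "\<And>\<nu>. (\<forall>f\<in>B'. \<bar>pairing \<nu> f - pairing \<mu> f\<bar> < e') \<Longrightarrow> \<nu> \<in> V"
      using UV \<mu> unfolding open_tempered_def by blast
    show "\<exists>B. schwartz_bounded B \<and>
            (\<exists>e>0. \<forall>\<nu>. (\<forall>f\<in>B. \<bar>pairing \<nu> f - pairing \<mu> f\<bar> < e) \<longrightarrow> \<nu> \<in> U \<inter> V)"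
    proof (rule exI[of _ "B \<union> B'"], intro conjI exI[of _ "min e e'"])
      show "schwartz_bounded (B \<union> B')"
        using 1(1) 2(1) by (simp add: schwartz_bounded_def image_Un)
      show "min e e' > 0"
        using 1 2 by simp
      show "\<forall>\<nu>. (\<forall>f\<in>B \<union> B'. \<bar>pairing \<nu> f - pairing \<mu> f\<bar> < min e e') \<longrightarrow> \<nu> \<in> U \<inter> V"
        using 1(3) 2(3) by simp
    qed
  qed
next
  fix K :: "tempered set set"
  assume "\<forall>U\<in>K. open U"
  then show "open (\<Union>K)"
    unfolding open_tempered_def by (meson UnionE UnionI)
qed

end

lemma tendsto_tempered_iff:
  "(\<mu> \<longlongrightarrow> l) F \<longleftrightarrow>
     (\<forall>B. schwartz_bounded B \<longrightarrow>
        (\<forall>e>0. eventually (\<lambda>s. \<forall>f\<in>B. \<bar>pairing (\<mu> s) f - pairing l f\<bar> < e) F))"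
proof (intro iffI allI impI)
  fix B and e :: real
  assume lim: "(\<mu> \<longlongrightarrow> l) F" and B: "schwartz_bounded B" and e: "e > 0"
  define U where "U = {\<nu>. \<exists>d<e. \<forall>f\<in>B. \<bar>pairing \<nu> f - pairing l f\<bar> \<le> d}"
  have "open U"
    unfolding open_tempered_def
  proof
    fix \<nu> assume "\<nu> \<in> U"
    then obtain d where d: "d < e" "\<And>f. f \<in> B \<Longrightarrow> \<bar>pairing \<nu> f - pairing l f\<bar> \<le> d"
      unfolding U_def by blast
    have "\<nu>' \<in> U" if close: "\<forall>f\<in>B. \<bar>pairing \<nu>' f - pairing \<nu> f\<bar> < (e - d) / 2" for \<nu>'
    proof -
      have "\<bar>pairing \<nu>' f - pairing l f\<bar> \<le> (e + d) / 2" if f: "f \<in> B" for f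
        using d(2)[OF f] bspec[OF close f] by (simp only: field_simps) argo
      then show ?thesis
        unfolding U_def using d(1) by (auto intro!: exI[of _ "(e + d) / 2"])
    qed
    then show "\<exists>B. schwartz_bounded B \<and>
        (\<exists>e>0. \<forall>\<nu>'. (\<forall>f\<in>B. \<bar>pairing \<nu>' f - pairing \<nu> f\<bar> < e) \<longrightarrow> \<nu>' \<in> U)"
      using B d(1) by (intro exI[of _ B] conjI exI[of _ "(e - d) / 2"]) auto
  qed
  moreover have "l \<in> U"
    using e by (auto simp: U_def)
  ultimately have "eventually (\<lambda>s. \<mu> s \<in> U) F"
    using lim by (simp add: topological_tendstoD)
  then show "eventually (\<lambda>s. \<forall>f\<in>B. \<bar>pairing (\<mu> s) f - pairing l f\<bar> < e) F"
    by eventually_elim (auto simp: U_def intro: le_less_trans)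
next
  assume *: "\<forall>B. schwartz_bounded B \<longrightarrow>
        (\<forall>e>0. eventually (\<lambda>s. \<forall>f\<in>B. \<bar>pairing (\<mu> s) f - pairing l f\<bar> < e) F)"
  show "(\<mu> \<longlongrightarrow> l) F"
  proof (rule topological_tendstoI)
    fix U assume "open U" "l \<in> U"
    then obtain B e where "schwartz_bounded B" "e > 0"
      and U: "\<And>\<nu>. (\<forall>f\<in>B. \<bar>pairing \<nu> f - pairing l f\<bar> < e) \<Longrightarrow> \<nu> \<in> U"
      unfolding open_tempered_def by blast
    then have "eventually (\<lambda>s. \<forall>f\<in>B. \<bar>pairing (\<mu> s) f - pairing l f\<bar> < e) F"
      using * by blast
    then show "eventually (\<lambda>s. \<mu> s \<in> U) F"
      by eventually_elim (rule U)
  qed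
qed


section \<open>Right-continuous trajectories with left limits\<close>

text \<open>
  A trajectory on \<open>{0..T}\<close> is represented by a total function, whose values outside
  \<open>{0..T}\<close> are irrelevant.
\<close>

definition skorokhod :: "real \<Rightarrow> (real \<Rightarrow> 'a::topological_space) set" where
  "skorokhod T =
     {\<mu>. (\<forall>t\<in>{0..<T}. (\<mu> \<longlongrightarrow> \<mu> t) (at t within {t..T})) \<and>
         (\<forall>t\<in>{0<..T}. \<exists>l. (\<mu> \<longlongrightarrow> l) (at t within {0..<t}))}"


section \<open>Test functions\<close>

text \<open>One-sided at the endpoints of \<open>{0..T}\<close>.\<close>

definition time_deriv :: "real \<Rightarrow> (real \<Rightarrow> real \<Rightarrow> real) \<Rightarrow> real \<Rightarrow> real \<Rightarrow> real" where
  "time_deriv T H s x = vector_derivative (\<lambda>r. H r x) (at s within {0..T})"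

text \<open>
  \<open>C\<^sup>1\<close> in time and smooth in space is read jointly: the derivatives of order at most one in
  time and of any order in space exist and are continuous on \<open>{0..T} \<times> UNIV\<close>.
  The values of \<open>H\<close> at times outside \<open>{0..T}\<close> are irrelevant.
\<close>

definition test_functions :: "real \<Rightarrow> (real \<Rightarrow> real \<Rightarrow> real) set" where
  "test_functions T =
     {H. (\<forall>s\<in>{0..T}. \<forall>x. (\<lambda>r. H r x) differentiable (at s within {0..T})) \<and>
         (\<forall>s\<in>{0..T}. smooth (H s) \<and> smooth (time_deriv T H s)) \<and>
         (\<forall>k. continuous_on ({0..T} \<times> UNIV) (\<lambda>(s, x). (deriv ^^ k) (H s) x)) \<and>
         (\<forall>k. continuous_on ({0..T} \<times> UNIV) (\<lambda>(s, x). (deriv ^^ k) (time_deriv T H s) x)) \<and>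
         compact (closure {(s, x). s \<in> {0..T} \<and> H s x \<noteq> 0})}"


section \<open>The functional\<close>

definition A_coeff :: "real \<Rightarrow> real" where
  "A_coeff \<rho> = (1 - \<rho>) * (2 * \<rho> - 1) / \<rho>"

text \<open>
  The arguments of \<open>Abs_schwartz\<close> below are Schwartz functions by
  \<open>test_functions_schwartz\<close>, so the abstraction is meaningful.
\<close>

definition Q_asym_dyn :: "real \<Rightarrow> real \<Rightarrow> (real \<Rightarrow> tempered) \<Rightarrow> ereal" where
  "Q_asym_dyn T \<rho> \<mu> =
     (SUP H\<in>test_functions T. ereal
        (pairing (\<mu> T) (Abs_schwartz (H T)) - pairing (\<mu> 0) (Abs_schwartz (H 0))
         - integral {0..T} (\<lambda>s. pairing (\<mu> s)
             (Abs_schwartz (\<lambda>x. time_deriv T H s x + deriv A_coeff \<rho> * deriv (H s) x)))))"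

lemma test_functions_schwartz:
  assumes H: "H \<in> test_functions T" and T: "T > 0" and s: "s \<in> {0..T}"
  shows "H s \<in> schwartz_functions"
    and "(\<lambda>x. time_deriv T H s x + a * deriv (H s) x) \<in> schwartz_functions"
proof -
  have sm: "smooth (H s)" "smooth (time_deriv T H s)"
    using H s by (auto simp: test_functions_def)
  have "bounded (closure {(s, x). s \<in> {0..T} \<and> H s x \<noteq> 0})"
    using H by (auto simp: test_functions_def intro: compact_imp_bounded)
  then obtain R where R: "\<And>z. z \<in> closure {(s, x). s \<in> {0..T} \<and> H s x \<noteq> 0} \<Longrightarrow> norm z \<le> R"
    by (auto simp: bounded_iff)
  have van: "H r x = 0" if r: "r \<in> {0..T}" and x: "\<bar>x\<bar> > R" for r x
  proof (rule ccontr)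
    assume "H r x \<noteq> 0"
    then have "(r, x) \<in> closure {(s, x). s \<in> {0..T} \<and> H s x \<noteq> 0}"
      using r by (intro subsetD[OF closure_subset]) auto
    then have "norm (r, x) \<le> R"
      by (rule R)
    then show False
      using x norm_snd_le[of x r] by simp
  qed
  have vant: "time_deriv T H s x = 0" if x: "\<bar>x\<bar> > R" for x
  proof -
    have "((\<lambda>r. 0 :: real) has_vector_derivative 0) (at s within {0..T})"
      by simp
    then have "((\<lambda>r. H r x) has_vector_derivative 0) (at s within {0..T})"
      by (rule has_vector_derivative_transform[OF s, rotated]) (use van x in auto)
    then show ?thesis
      unfolding time_deriv_def
      using s T by (intro vector_derivative_within_closed_interval) auto
  qed
  show 1: "H s \<in> schwartz_functions"
    by (rule schwartz_functions_if_vanishing[OF sm(1), of R]) (use van s in auto)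
  have 2: "time_deriv T H s \<in> schwartz_functions"
    by (rule schwartz_functions_if_vanishing[OF sm(2), of R]) (use vant in auto)
  have 3: "deriv (H s) \<in> schwartz_functions"
  proof (rule schwartz_functions_if_vanishing[OF smooth_deriv[OF sm(1)], of R])
    fix x :: real
    assume x: "\<bar>x\<bar> > R"
    have "open {y::real. \<bar>y\<bar> > R}"
      by (intro open_Collect_less continuous_intros)
    then have "eventually (\<lambda>y. y \<in> {y. \<bar>y\<bar> > R}) (nhds x)"
      using x by (intro eventually_nhds_in_open) auto
    then have "eventually (\<lambda>y. H s y = 0) (nhds x)"
      by eventually_elim (use van s in auto)
    then have "deriv (H s) x = deriv (\<lambda>_. 0) x"
      by (intro deriv_cong_ev) auto
    then show "deriv (H s) x = 0" by simp
  qed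
  show "(\<lambda>x. time_deriv T H s x + a * deriv (H s) x) \<in> schwartz_functions"
    using schwartz_functions_lincomb[OF 2 3, of 1 a] by simp
qed

end

theory Submission
  imports Defs
begin

text \<open>
  The expression inside the supremum is homogeneous of degree one in \<open>H\<close>, and the test functions
  are closed under scaling. A supremum of such a functional is either \<open>0\<close> or \<open>+\<infinity>\<close>.
\<close>

lemma SUP_homogeneous_eq_0:
  fixes L :: "'a \<Rightarrow> real"
  assumes z: "z \<in> S" "L z = 0"
    and scale: "\<And>c x. x \<in> S \<Longrightarrow> \<exists>y\<in>S. L y = c * L x"
    and fin: "(SUP x\<in>S. ereal (L x)) < \<infinity>"
  shows "(SUP x\<in>S. ereal (L x)) = 0"
proof (rule antisym)
  obtain n where "(SUP x\<in>S. ereal (L x)) < ereal (real n)"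
    using fin less_PInf_Ex_of_nat[of "SUP x\<in>S. ereal (L x)"] by auto
  then have M: "L x \<le> real n" if "x \<in> S" for x
    using SUP_lessD[OF _ that] by fastforce
  have "L x \<le> 0" if x: "x \<in> S" for x
  proof (rule ccontr)
    assume "\<not> L x \<le> 0"
    \<comment> \<open>The factor divides by \<open>L x\<close>, which is positive here; it is chosen
      so that the scaled element exceeds the bound \<open>real n\<close> by exactly 1.\<close>
    then obtain y where "y \<in> S" "L y = real n + 1"
      using scale[OF x, of "(real n + 1) / L x"] by auto
    then show False
      using M[of y] by simp
  qed
  then show "(SUP x\<in>S. ereal (L x)) \<le> 0"
    by (intro SUP_least) simp
  show "0 \<le> (SUP x\<in>S. ereal (L x))"
    using SUP_upper[OF z(1), of "\<lambda>x. ereal (L x)"] z(2) by (simp add: zero_ereal_def)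
qed

lemma smooth_cmult: "smooth f \<Longrightarrow> smooth (\<lambda>x. c * f x)"
  using smooth_lincomb[of f f c 0] by simp

lemma higher_deriv_cmult:
  "smooth f \<Longrightarrow> (deriv ^^ k) (\<lambda>x. c * f x) = (\<lambda>x. c * (deriv ^^ k) f x)"
  using higher_deriv_lincomb[of f f k c 0] by simp

lemma deriv_cmult_smooth: "smooth f \<Longrightarrow> deriv (\<lambda>x. c * f x) = (\<lambda>x. c * deriv f x)"
  using higher_deriv_cmult[of f 1 c] by simp

lemma Abs_schwartz_cmult:
  assumes "f \<in> schwartz_functions"
  shows "Abs_schwartz (\<lambda>x. c * f x) = c *\<^sub>R Abs_schwartz f"
  using assms by (simp add: scaleR_schwartz_def Abs_schwartz_inverse)

text \<open>Linearity of \<open>pairing \<mu>\<close> lives on the type \<open>schwartz\<close>. It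
  passes to raw functions only where \<open>Abs_schwartz\<close> inverts
  \<open>schwartz_fun\<close>, hence the membership assumption.\<close>

lemma pairing_cmult:
  assumes "f \<in> schwartz_functions"
  shows "pairing \<mu> (Abs_schwartz (\<lambda>x. c * f x)) = c * pairing \<mu> (Abs_schwartz f)"
proof -
  have "linear (pairing \<mu>)"
    using pairing[of \<mu>] by simp
  then show ?thesis
    by (simp add: Abs_schwartz_cmult[OF assms] linear_cmul)
qed

text \<open>Differentiability in time makes the value chosen by \<open>vector_derivative\<close> a
  true derivative, and \<open>T > 0\<close> makes derivatives within \<open>{0..T}\<close> unique,
  also at the endpoints.\<close>

lemma time_deriv_cmult:
  assumes H: "H \<in> test_functions T" and T: "T > 0" and s: "s \<in> {0..T}"
  shows "time_deriv T (\<lambda>s x. c * H s x) s = (\<lambda>x. c * time_deriv T H s x)"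
proof
  fix x
  have "((\<lambda>r. H r x) has_vector_derivative time_deriv T H s x) (at s within {0..T})"
    using H s by (simp add: test_functions_def time_deriv_def vector_derivative_works[symmetric])
  then have "((\<lambda>r. c * H r x) has_vector_derivative c * time_deriv T H s x) (at s within {0..T})"
    by (rule has_vector_derivative_mult_right)
  then show "time_deriv T (\<lambda>s x. c * H s x) s x = c * time_deriv T H s x"
    unfolding time_deriv_def[of T "\<lambda>s x. c * H s x"]
    using s T by (intro vector_derivative_within_closed_interval) auto
qed

lemma test_functions_cmult:
  assumes H: "H \<in> test_functions T" and T: "T > 0"
  shows "(\<lambda>s x. c * H s x) \<in> test_functions T"
proof -
  let ?G = "\<lambda>s x. c * H s x"
  have sm: "smooth (H s)" "smooth (time_deriv T H s)" if "s \<in> {0..T}" for s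
    using H that by (auto simp: test_functions_def)
  have "(\<lambda>r. ?G r x) differentiable (at s within {0..T})" if "s \<in> {0..T}" for s x
    using H that by (intro differentiable_mult) (auto simp: test_functions_def)
  moreover have "smooth (?G s)" "smooth (time_deriv T ?G s)" if "s \<in> {0..T}" for s
    using sm[OF that] by (simp_all add: time_deriv_cmult[OF H T that] smooth_cmult)
  moreover have "continuous_on ({0..T} \<times> UNIV) (\<lambda>(s, x). (deriv ^^ k) (?G s) x)" for k
  proof -
    have "continuous_on ({0..T} \<times> UNIV) (\<lambda>p. c * (\<lambda>(s, x). (deriv ^^ k) (H s) x) p)"
      using H by (intro continuous_intros) (auto simp: test_functions_def)
    then show ?thesis
      \<comment> \<open>Smoothness of \<open>H s\<close> is known only for \<open>s\<close> in
        \<open>{0..T}\<close>, so the two functions are compared on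
        \<open>{0..T} \<times> UNIV\<close> alone.\<close>
      by (rule continuous_on_eq) (auto simp: higher_deriv_cmult sm)
  qed
  moreover have "continuous_on ({0..T} \<times> UNIV) (\<lambda>(s, x). (deriv ^^ k) (time_deriv T ?G s) x)" for k
  proof -
    have "continuous_on ({0..T} \<times> UNIV) (\<lambda>p. c * (\<lambda>(s, x). (deriv ^^ k) (time_deriv T H s) x) p)"
      using H by (intro continuous_intros) (auto simp: test_functions_def)
    then show ?thesis
      by (rule continuous_on_eq) (auto simp: time_deriv_cmult[OF H T] higher_deriv_cmult sm)
  qed
  moreover have "compact (closure {(s, x). s \<in> {0..T} \<and> ?G s x \<noteq> 0})"
  \<comment> \<open>In a Euclidean space a closure is compact iff the set is bounded. Scaling cannot
    enlarge the set where \<open>H\<close> is nonzero, and \<open>c = 0\<close> empties it.\<close>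
  proof (rule compact_closure[THEN iffD2], rule bounded_subset)
    show "bounded {(s, x). s \<in> {0..T} \<and> H s x \<noteq> 0}"
      using H by (simp add: test_functions_def)
  qed auto
  ultimately show ?thesis
    by (simp add: test_functions_def)
qed

text \<open>Scaling only produces test functions from a given one. This one makes the family
  nonempty and yields the lower bound 0 of the supremum.\<close>

lemma zero_test_functions:
  assumes T: "T > 0"
  shows "(\<lambda>s x. 0) \<in> test_functions T"
proof -
  have td: "time_deriv T (\<lambda>s x. 0) s = (\<lambda>x. 0)" if "s \<in> {0..T}" for s
    unfolding time_deriv_def
    using that T by (intro ext vector_derivative_within_closed_interval) auto
  have sm: "smooth (\<lambda>x. 0)"
    using zero_schwartz_functions by (simp add: schwartz_functions_def)
  have hd: "(deriv ^^ k) (\<lambda>x. 0) = (\<lambda>x::real. 0::real)" for k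
    by (induction k) auto
  have "continuous_on ({0..T} \<times> UNIV) (\<lambda>(s, x). (deriv ^^ k) (time_deriv T (\<lambda>s x. 0) s) x)" for k
    by (rule continuous_on_eq[where f = "\<lambda>_. 0"]) (auto simp: td hd)
  then show ?thesis
    by (simp add: test_functions_def td sm hd case_prod_unfold)
qed

theorem lemma5p3:
  fixes \<rho> T :: real and \<mu> :: "real \<Rightarrow> tempered"
  assumes "\<rho> \<in> {1/2<..<1}"
    and "T > 0"
    and "\<mu> \<in> skorokhod T"
    and "Q_asym_dyn T \<rho> \<mu> < \<infinity>"
  shows "Q_asym_dyn T \<rho> \<mu> = 0"
proof -
  note T = \<open>T > 0\<close>
  \<comment> \<open>The transport operator with constant velocity
    \<open>deriv A_coeff \<rho>\<close>; it is linear in \<open>H\<close>, which is the source of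
    the homogeneity of \<open>L\<close>.\<close>
  define D where "D H s x = time_deriv T H s x + deriv A_coeff \<rho> * deriv (H s) x" for H s x
  define L where "L H = pairing (\<mu> T) (Abs_schwartz (H T)) - pairing (\<mu> 0) (Abs_schwartz (H 0))
      - integral {0..T} (\<lambda>s. pairing (\<mu> s) (Abs_schwartz (D H s)))" for H
  have Q: "Q_asym_dyn T \<rho> \<mu> = (SUP H\<in>test_functions T. ereal (L H))"
    by (simp add: Q_asym_dyn_def L_def D_def[abs_def])
  have hom: "L (\<lambda>s x. c * H s x) = c * L H" if H: "H \<in> test_functions T" for c H
  proof -
    have "pairing (\<mu> s) (Abs_schwartz (D (\<lambda>s x. c * H s x) s)) = c * pairing (\<mu> s) (Abs_schwartz (D H s))"
      if s: "s \<in> {0..T}" for s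
    proof -
      have "smooth (H s)"
        using H s by (auto simp: test_functions_def)
      then have "D (\<lambda>s x. c * H s x) s = (\<lambda>x. c * D H s x)"
        by (simp add: D_def[abs_def] time_deriv_cmult[OF H T s] deriv_cmult_smooth algebra_simps)
      moreover have "D H s \<in> schwartz_functions"
        unfolding D_def[abs_def] by (rule test_functions_schwartz(2)[OF H T s])
      ultimately show ?thesis
        by (simp add: pairing_cmult)
    qed
    then have "integral {0..T} (\<lambda>s. pairing (\<mu> s) (Abs_schwartz (D (\<lambda>s x. c * H s x) s)))
        = integral {0..T} (\<lambda>s. c * pairing (\<mu> s) (Abs_schwartz (D H s)))"
      by (rule integral_cong)
    \<comment> \<open>This also covers a non-integrable integrand: its \<open>integral\<close> is 0
      by convention, and so is that of its multiple by any \<open>c\<close>.\<close>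
    also have "\<dots> = c * integral {0..T} (\<lambda>s. pairing (\<mu> s) (Abs_schwartz (D H s)))"
      by simp
    finally have "integral {0..T} (\<lambda>s. pairing (\<mu> s) (Abs_schwartz (D (\<lambda>s x. c * H s x) s)))
        = c * integral {0..T} (\<lambda>s. pairing (\<mu> s) (Abs_schwartz (D H s)))" .
    then show ?thesis
      using test_functions_schwartz(1)[OF H T] T
      by (simp add: L_def pairing_cmult algebra_simps)
  qed
  show ?thesis
    unfolding Q
  proof (rule SUP_homogeneous_eq_0)
    show "(\<lambda>s x. 0) \<in> test_functions T"
      by (rule zero_test_functions[OF T])
    \<comment> \<open>The zero function is its own multiple by 0, so homogeneity with factor 0 gives
      the value.\<close>
    then show "L (\<lambda>s x. 0) = 0"
      using hom[of "\<lambda>s x. 0" 0] by simp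
    show "\<exists>G\<in>test_functions T. L G = c * L H" if "H \<in> test_functions T" for c H
      using test_functions_cmult[OF that T] hom[OF that] by blast
    show "(SUP H\<in>test_functions T. ereal (L H)) < \<infinity>"
      using assms(4) by (simp add: Q)
  qed
qed

end
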